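(* Let $\mathcal{F},\mathcal{G}$ be regular thin families with $o(\mathcal{F})\leq o(\mathcal{G})$. Then for every $M\in[\mathbb{N}]^\infty$ there exist $N\in[\mathbb{N}]^\infty$ and a plegma preserving map $\varphi:\mathcal{G}\upharpoonright N\to\mathcal{F}\upharpoonright M$. Moreover, for every $l\in\mathbb{N}$ and $t\in\mathcal{G}\upharpoonright N$, if $\min t\geq N(l)$ then $\min\varphi(t)\geq M(l)$.
   Context: $\mathbb{N}=\{1,2,\dots\}$. For $M\subseteq\mathbb{N}$, $[M]^{<\infty}$ and $[M]^\infty$ denote the sets of finite, respectively infinite, subsets of $M$. For $s\subseteq\mathbb{N}$ (finite or infinite), $s(k)$ is the $k$-th element of $s$ in increasing order and $|s|$ its cardinality. $t\sqsubseteq s$ (resp. $t\sqsubset s$) means that $t$ is an initial (resp. proper initial) segment of $s$. For $\mathcal{F}\subseteq[\mathbb{N}]^{<\infty}$, $\mathcal{F}\upharpoonright M=\mathcal{F}\cap[M]^{<\infty}$ and $\widehat{\mathcal{F}}=\{t\in[\mathbb{N}]^{<\infty}:\exists s\in\mathcal{F},\ t\sqsubseteq s\}$. A family $\mathcal{R}\subseteq[\mathbb{N}]^{<\infty}$ is regular if it is hereditary (closed under subsets), spreading (if $\{n_1<\dots<n_k\}\in\mathcal{R}$, $m_1<\dots<m_k$ and $n_i\leq m_i$ for all $i$, then $\{m_1,\dots,m_k\}\in\mathcal{R}$) and compact (the set of characteristic functions of its members is closed in $\{0,1\}^{\mathbb{N}}$). $\mathcal{F}$ is thin if no element of $\mathcal{F}$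 is a proper initial segment of another one. $\mathcal{F}$ is regular thin if it is thin and $\widehat{\mathcal{F}}$ is regular. The order $o(\mathcal{F})$ of a nonempty family: if $\widehat{\mathcal{F}}$ contains an infinite $\sqsubset$-increasing sequence, $o(\mathcal{F})=\omega_1$; otherwise put $o_{\widehat{\mathcal{F}}}(s)=0$ for $\sqsubseteq$-maximal $s\in\widehat{\mathcal{F}}$, recursively $o_{\widehat{\mathcal{F}}}(s)=\sup\{o_{\widehat{\mathcal{F}}}(t)+1:t\in\widehat{\mathcal{F}},\ s\sqsubset t\}$, and $o(\mathcal{F})=o_{\widehat{\mathcal{F}}}(\varnothing)$. A pair $(s_1,s_2)$ of nonempty finite subsets of $\mathbb{N}$ is a plegma pair if $s_1(k)<s_2(k)$ for all $k\leq\min(|s_1|,|s_2|)$, and for all $i,j\in\{1,2\}$, $s_i(k)<s_j(k+1)$ whenever $k\leq\min(|s_i|,|s_j|-1)$. A map $\varphi$ from a family $\mathcal{H}\subseteq[\mathbb{N}]^{<\infty}$ to $[\mathbb{N}]^{<\infty}$ is plegma preserving if $(\varphi(s_1),\varphi(s_2))$ is a plegma pair whenever $(s_1,s_2)$ is a plegma pair of elements of $\mathcal{H}$.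
   Formalization: The degenerate case where F = {∅} while G ≠ {∅} is excluded; there the claim is false, since φ would be constantly ∅ while plegma pairs consist of nonempty sets (e.g. G the family of all singletons). *)

theory Defs
  imports "HOL-Analysis.Analysis"
begin

section \<open>The ordinals up to the first uncountable one\<close>

text \<open>
  \<open>cardSuc natLeq\<close> is a well-order of type \<open>\<omega>\<^sub>1\<close>.  Its downward closed subsets, ordered by
  inclusion, represent the ordinals \<open>\<alpha> \<le> \<omega>\<^sub>1\<close>: the subset for \<open>\<alpha>\<close> has order type \<open>\<alpha>\<close>, so that
  \<open>bot\<close> is \<open>0\<close> and \<open>top\<close> is \<open>\<omega>\<^sub>1\<close>.
\<close>

abbreviation omega1_rel :: "nat set rel" where
  "omega1_rel \<equiv> cardSuc natLeq"

lemma wo_rel_omega1_rel: "wo_rel omega1_rel"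
  using cardSuc_Card_order[OF natLeq_Card_order]
  by (auto simp: wo_rel_def card_order_on_def)

typedef ord_omega1 = "{A. ofilter omega1_rel A}"
  morphisms ord_set Abs_ord
  using wo_rel.Field_ofilter[OF wo_rel_omega1_rel] by blast

setup_lifting type_definition_ord_omega1

instantiation ord_omega1 :: complete_linorder
begin

lift_definition less_eq_ord_omega1 :: "ord_omega1 \<Rightarrow> ord_omega1 \<Rightarrow> bool" is "(\<subseteq>)" .
lift_definition less_ord_omega1 :: "ord_omega1 \<Rightarrow> ord_omega1 \<Rightarrow> bool" is "(\<subset>)" .
lift_definition bot_ord_omega1 :: ord_omega1 is "{}"
  by (simp add: ofilter_def)
lift_definition top_ord_omega1 :: ord_omega1 is "Field omega1_rel"
  by (rule wo_rel.Field_ofilter[OF wo_rel_omega1_rel])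
lift_definition sup_ord_omega1 :: "ord_omega1 \<Rightarrow> ord_omega1 \<Rightarrow> ord_omega1" is "(\<union>)"
  by (auto simp: ofilter_def)
lift_definition inf_ord_omega1 :: "ord_omega1 \<Rightarrow> ord_omega1 \<Rightarrow> ord_omega1" is "(\<inter>)"
  by (auto simp: ofilter_def)
lift_definition Sup_ord_omega1 :: "ord_omega1 set \<Rightarrow> ord_omega1" is "\<lambda>X. \<Union> X"
  by (fastforce simp: ofilter_def)
lift_definition Inf_ord_omega1 :: "ord_omega1 set \<Rightarrow> ord_omega1"
  is "\<lambda>X. Field omega1_rel \<inter> \<Inter> X"
  using wo_rel.Field_ofilter[OF wo_rel_omega1_rel] by (fastforce simp: ofilter_def)

instance
proof
  fix x y :: ord_omega1
  show "x \<le> y \<or> y \<le> x"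
    by transfer (simp add: wo_rel.ofilter_linord[OF wo_rel_omega1_rel])
next
  fix z :: ord_omega1 and A :: "ord_omega1 set"
  assume "\<And>x. x \<in> A \<Longrightarrow> z \<le> x"
  then show "z \<le> Inf A" by transfer (fastforce simp: ofilter_def)
qed (transfer; (fast | blast))+

end

lemma ord_set_less_iff: "a < b \<longleftrightarrow> (\<exists>x\<in>ord_set b. ord_set a = underS omega1_rel x)"
proof
  assume ab: "a < b"
  have "ofilter omega1_rel (ord_set a)" "ofilter omega1_rel (ord_set b)"
    using ord_set by auto
  moreover have sub: "ord_set a \<subset> ord_set b" using ab by transfer
  moreover from calculation have "ord_set a \<noteq> Field omega1_rel"
    by (auto simp: ofilter_def)
  ultimately obtain x where x: "x \<in> Field omega1_rel" "ord_set a = underS omega1_rel x"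
    using wo_rel.ofilter_underS_Field[OF wo_rel_omega1_rel] by blast
  from sub obtain y where y: "y \<in> ord_set b" "y \<notin> ord_set a" by blast
  then have yF: "y \<in> Field omega1_rel"
    using \<open>ofilter omega1_rel (ord_set b)\<close> by (auto simp: ofilter_def)
  have "x = y \<or> (x, y) \<in> omega1_rel"
    using wo_rel.TOTALS[OF wo_rel_omega1_rel] x y(2) yF by (auto simp: underS_def)
  then have "x \<in> ord_set b"
    using y(1) \<open>ofilter omega1_rel (ord_set b)\<close> by (auto simp: ofilter_def under_def)
  with x show "\<exists>x\<in>ord_set b. ord_set a = underS omega1_rel x" by blast
next
  assume "\<exists>x\<in>ord_set b. ord_set a = underS omega1_rel x"
  then obtain x where x: "x \<in> ord_set b" "ord_set a = underS omega1_rel x" by blast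
  have "ofilter omega1_rel (ord_set b)" using ord_set by auto
  then have "ord_set a \<subseteq> ord_set b" using x by (auto simp: ofilter_def under_def underS_def)
  moreover have "x \<notin> ord_set a" using x by (simp add: underS_def)
  ultimately have "ord_set a \<subset> ord_set b" using x by blast
  then show "a < b" by transfer
qed

instance ord_omega1 :: wellorder
proof
  fix P :: "ord_omega1 \<Rightarrow> bool" and a :: ord_omega1
  assume step: "\<And>x. (\<And>y. y < x \<Longrightarrow> P y) \<Longrightarrow> P x"
  have *: "\<forall>b. ord_set b = underS omega1_rel x \<longrightarrow> P b" for x
  proof (rule wo_rel.well_order_induct[OF wo_rel_omega1_rel])
    fix x
    assume IH: "\<forall>y. y \<noteq> x \<and> (y, x) \<in> omega1_rel \<longrightarrow>
      (\<forall>b. ord_set b = underS omega1_rel y \<longrightarrow> P b)"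
    show "\<forall>b. ord_set b = underS omega1_rel x \<longrightarrow> P b"
    proof (rule allI, rule impI, rule step)
      fix b c
      assume b: "ord_set b = underS omega1_rel x" and "c < b"
      then obtain y where y: "y \<in> ord_set b" "ord_set c = underS omega1_rel y"
        by (auto simp: ord_set_less_iff)
      from y(1) have "y \<noteq> x \<and> (y, x) \<in> omega1_rel"
        unfolding b underS_def by simp
      with IH y(2) show "P c" by blast
    qed
  qed
  show "P a"
  proof (rule step)
    fix c assume "c < a"
    then obtain y where "ord_set c = underS omega1_rel y"
      by (auto simp: ord_set_less_iff)
    with * show "P c" by blast
  qed
qed

lemma ord_set_Abs_underS:
  assumes "x \<in> Field omega1_rel"
  shows "ord_set (Abs_ord (underS omega1_rel x)) = underS omega1_rel x"
  using wo_rel.underS_ofilter[OF wo_rel_omega1_rel] by (simp add: Abs_ord_inverse)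

lemma ord_set_Field: "ord_set a \<subseteq> Field omega1_rel"
  using ord_set[of a] by (auto simp: ofilter_def)

lemma bij_betw_ord_set:
  "bij_betw (\<lambda>x. Abs_ord (underS omega1_rel x)) (ord_set a) {b. b < a}"
  unfolding bij_betw_def
proof
  show "inj_on (\<lambda>x. Abs_ord (underS omega1_rel x)) (ord_set a)"
  proof (rule inj_onI)
    fix x y
    assume "x \<in> ord_set a" "y \<in> ord_set a"
      and eq: "Abs_ord (underS omega1_rel x) = Abs_ord (underS omega1_rel y)"
    then have F: "x \<in> Field omega1_rel" "y \<in> Field omega1_rel" using ord_set_Field by blast+
    have "ord_set (Abs_ord (underS omega1_rel x)) = ord_set (Abs_ord (underS omega1_rel y))"
      by (rule arg_cong[OF eq])
    then have "underS omega1_rel x = underS omega1_rel y"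
      by (simp only: ord_set_Abs_underS[OF F(1)] ord_set_Abs_underS[OF F(2)])
    moreover have "x = y \<or> x \<in> underS omega1_rel y \<or> y \<in> underS omega1_rel x"
      using F wo_rel.TOTALS[OF wo_rel_omega1_rel] unfolding underS_def by blast
    ultimately show "x = y" unfolding underS_def by blast
  qed
  show "(\<lambda>x. Abs_ord (underS omega1_rel x)) ` ord_set a = {b. b < a}"
  proof (intro equalityI subsetI)
    fix b assume "b \<in> (\<lambda>x. Abs_ord (underS omega1_rel x)) ` ord_set a"
    then show "b \<in> {b. b < a}"
      using ord_set_Field ord_set_Abs_underS ord_set_less_iff by blast
  next
    fix b assume "b \<in> {b. b < a}"
    then obtain x where "x \<in> ord_set a" "ord_set b = underS omega1_rel x"
      by (auto simp: ord_set_less_iff)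
    then show "b \<in> (\<lambda>x. Abs_ord (underS omega1_rel x)) ` ord_set a"
      by (metis ord_set_inverse image_eqI)
  qed
qed

lemma countable_iff_ordLeq_natLeq:
  includes cardinal_syntax
  shows "countable A \<longleftrightarrow> |A| \<le>o natLeq"
proof -
  have "countable A \<longleftrightarrow> |A| \<le>o |UNIV :: nat set|"
    unfolding countable_def card_of_ordLeq[symmetric] by simp
  also have "\<dots> \<longleftrightarrow> |A| \<le>o natLeq"
    using card_of_nat ordLeq_ordIso_trans ordIso_symmetric by blast
  finally show ?thesis .
qed

lemma countable_below:
  includes cardinal_syntax
  assumes "(a :: ord_omega1) < top"
  shows "countable {b. b < a}"
proof -
  obtain x where x: "x \<in> Field omega1_rel" "ord_set a = underS omega1_rel x"
    using assms by (auto simp: ord_set_less_iff top_ord_omega1.rep_eq)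
  have "|underS omega1_rel x| <o omega1_rel"
    by (rule card_of_underS[OF cardSuc_Card_order[OF natLeq_Card_order] x(1)])
  then have "|underS omega1_rel x| \<le>o natLeq"
    by (simp add: cardSuc_ordLeq_ordLess[OF natLeq_Card_order card_of_Card_order])
  then have "countable (ord_set a)"
    using x(2) by (simp add: countable_iff_ordLeq_natLeq)
  then show ?thesis
    using bij_betw_ord_set[of a] countable_image
    unfolding bij_betw_def by metis
qed

lemma uncountable_below_top:
  includes cardinal_syntax
  shows "uncountable {b. b < (top :: ord_omega1)}"
proof
  assume "countable {b. b < (top :: ord_omega1)}"
  then have "countable (Field omega1_rel)"
    using bij_betw_ord_set[of top]
      countable_image_inj_on[of "\<lambda>x. Abs_ord (underS omega1_rel x)" "Field omega1_rel"]
    unfolding bij_betw_def top_ord_omega1.rep_eq by auto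
  then have "|Field omega1_rel| \<le>o natLeq" by (simp add: countable_iff_ordLeq_natLeq)
  moreover have "omega1_rel =o |Field omega1_rel|"
    using card_of_Field_ordIso[OF cardSuc_Card_order[OF natLeq_Card_order]] ordIso_symmetric by blast
  ultimately have "omega1_rel \<le>o natLeq" using ordIso_ordLeq_trans by blast
  then show False
    using cardSuc_greater[OF natLeq_Card_order] not_ordLess_ordLeq by blast
qed

text \<open>The successor; the junk value \<open>ord_succ top = top\<close> is never met at countable ordinals.\<close>

definition ord_succ :: "ord_omega1 \<Rightarrow> ord_omega1" where
  "ord_succ a = Inf {b. a < b}"

lemma ord_succ_greater:
  assumes "a < top"
  shows "a < ord_succ a"
proof -
  have "(LEAST b. a < b) \<in> {b. a < b}" using assms LeastI[of "\<lambda>b. a < b" top] by simp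
  moreover have "ord_succ a = (LEAST b. a < b)"
    unfolding ord_succ_def using calculation
    by (intro antisym Inf_lower Inf_greatest) (auto intro: Least_le)
  ultimately show ?thesis by simp
qed


section \<open>Families of finite subsets of the positive integers\<close>

abbreviation Npos :: "nat set" where
  "Npos \<equiv> {1..}"

definition fin_subsets :: "nat set \<Rightarrow> nat set set" where
  "fin_subsets M = {s. s \<subseteq> M \<and> finite s}"

definition inf_subsets :: "nat set \<Rightarrow> nat set set" where
  "inf_subsets M = {s. s \<subseteq> M \<and> infinite s}"

text \<open>
  The \<open>k\<close>-th element of \<open>s\<close> in increasing order, counting from \<open>k = 1\<close>; for finite \<open>s\<close>
  it is meaningful for \<open>k \<le> card s\<close> only.
\<close>

definition nth_elem :: "nat set \<Rightarrow> nat \<Rightarrow> nat" where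
  "nth_elem s k = enumerate s (k - 1)"

definition init_seg :: "nat set \<Rightarrow> nat set \<Rightarrow> bool" where
  "init_seg t s \<longleftrightarrow> t \<subseteq> s \<and> (\<forall>x\<in>t. \<forall>y\<in>s. y < x \<longrightarrow> y \<in> t)"

definition proper_init_seg :: "nat set \<Rightarrow> nat set \<Rightarrow> bool" where
  "proper_init_seg t s \<longleftrightarrow> init_seg t s \<and> t \<noteq> s"

definition restrict_family :: "nat set set \<Rightarrow> nat set \<Rightarrow> nat set set" where
  "restrict_family F M = F \<inter> fin_subsets M"

definition hat :: "nat set set \<Rightarrow> nat set set" where
  "hat F = {t \<in> fin_subsets Npos. \<exists>s\<in>F. init_seg t s}"

definition hereditary :: "nat set set \<Rightarrow> bool" where
  "hereditary R \<longleftrightarrow> (\<forall>s\<in>R. \<forall>t. t \<subseteq> s \<longrightarrow> t \<in> R)"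

definition spreading :: "nat set set \<Rightarrow> bool" where
  "spreading R \<longleftrightarrow>
    (\<forall>s\<in>R. \<forall>t\<in>fin_subsets Npos.
       card t = card s \<and> (\<forall>k. 1 \<le> k \<and> k \<le> card s \<longrightarrow> nth_elem s k \<le> nth_elem t k) \<longrightarrow> t \<in> R)"

text \<open>Elements of \<open>{0, 1}\<^bsup>\<nat>\<^esup>\<close> are functions defined on \<open>Npos\<close>, extended by \<open>undefined\<close>.\<close>

definition char_fun :: "nat set \<Rightarrow> nat \<Rightarrow> nat" where
  "char_fun s = (\<lambda>n\<in>Npos. if n \<in> s then 1 else 0)"

definition compact_family :: "nat set set \<Rightarrow> bool" where
  "compact_family R \<longleftrightarrow>
    closedin (product_topology (\<lambda>_. discrete_topology {0, 1}) Npos) (char_fun ` R)"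

definition regular :: "nat set set \<Rightarrow> bool" where
  "regular R \<longleftrightarrow> R \<subseteq> fin_subsets Npos \<and> hereditary R \<and> spreading R \<and> compact_family R"

definition thin :: "nat set set \<Rightarrow> bool" where
  "thin F \<longleftrightarrow> (\<forall>s\<in>F. \<forall>t\<in>F. \<not> proper_init_seg s t)"

definition regular_thin :: "nat set set \<Rightarrow> bool" where
  "regular_thin F \<longleftrightarrow> F \<subseteq> fin_subsets Npos \<and> thin F \<and> regular (hat F)"


section \<open>The order of a family\<close>

definition has_infinite_chain :: "nat set set \<Rightarrow> bool" where
  "has_infinite_chain H \<longleftrightarrow> (\<exists>f :: nat \<Rightarrow> nat set. \<forall>n. f n \<in> H \<and> proper_init_seg (f n) (f (Suc n)))"

definition ext_rel :: "nat set set \<Rightarrow> nat set rel" where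
  "ext_rel H = {(t, s). s \<in> H \<and> t \<in> H \<and> proper_init_seg s t}"

text \<open>
  The recursion is along \<open>ext_rel H\<close>, which is well-founded when \<open>H\<close> has no infinite chain
  (see \<open>node_order_eq\<close>).  At maximal \<open>s\<close> the supremum is \<open>Sup {} = 0\<close>.
\<close>

definition node_order :: "nat set set \<Rightarrow> nat set \<Rightarrow> ord_omega1" where
  "node_order H =
    wfrec (ext_rel H) (\<lambda>f s. SUP t\<in>{t \<in> H. proper_init_seg s t}. ord_succ (f t))"

definition family_order :: "nat set set \<Rightarrow> ord_omega1" where
  "family_order F = (if has_infinite_chain (hat F) then top else node_order (hat F) {})"

lemma wf_ext_rel:
  assumes "\<not> has_infinite_chain H"
  shows "wf (ext_rel H)"
  using assms unfolding wf_iff_no_infinite_down_chain has_infinite_chain_def ext_rel_def by blast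

lemma node_order_eq:
  assumes "\<not> has_infinite_chain H" "s \<in> H"
  shows "node_order H s = (SUP t\<in>{t \<in> H. proper_init_seg s t}. ord_succ (node_order H t))"
  unfolding node_order_def
  by (subst wfrec[OF wf_ext_rel[OF assms(1)]], rule SUP_cong)
     (auto simp: cut_apply ext_rel_def assms(2))

lemma node_order_maximal:
  assumes "\<not> has_infinite_chain H" "s \<in> H" "\<And>t. t \<in> H \<Longrightarrow> \<not> proper_init_seg s t"
  shows "node_order H s = bot"
  using assms by (subst node_order_eq) auto


lemma family_order_singleton_empty: "family_order {{}} = bot"
proof -
  have "hat {{}} = {{}}" by (auto simp: hat_def init_seg_def fin_subsets_def)
  moreover have "\<not> has_infinite_chain {{}}"
    by (auto simp: has_infinite_chain_def proper_init_seg_def)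
  moreover from calculation have "node_order {{}} {} = bot"
    by (intro node_order_maximal) (auto simp: proper_init_seg_def)
  ultimately show ?thesis by (simp add: family_order_def)
qed


section \<open>Plegma pairs\<close>

definition plegma_pair :: "nat set \<Rightarrow> nat set \<Rightarrow> bool" where
  "plegma_pair s1 s2 \<longleftrightarrow>
    s1 \<in> fin_subsets Npos \<and> s2 \<in> fin_subsets Npos \<and> s1 \<noteq> {} \<and> s2 \<noteq> {} \<and>
    (\<forall>k. 1 \<le> k \<and> k \<le> min (card s1) (card s2) \<longrightarrow> nth_elem s1 k < nth_elem s2 k) \<and>
    (\<forall>s\<in>{s1, s2}. \<forall>t\<in>{s1, s2}. \<forall>k. 1 \<le> k \<and> k \<le> min (card s) (card t - 1) \<longrightarrow>
       nth_elem s k < nth_elem t (k + 1))"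

definition plegma_preserving :: "nat set set \<Rightarrow> (nat set \<Rightarrow> nat set) \<Rightarrow> bool" where
  "plegma_preserving H \<phi> \<longleftrightarrow>
    (\<forall>s1\<in>H. \<forall>s2\<in>H. plegma_pair s1 s2 \<longrightarrow> plegma_pair (\<phi> s1) (\<phi> s2))"

end

theory Submission
  imports Defs
begin

text \<open>
  Write \<open>R = hat F\<close>, \<open>S = hat G\<close> and let \<open>\<rho>\<close> be the rank (\<open>node_order\<close>) of a node in either tree.
  The map \<open>\<phi>\<close> is a relabelling followed by a truncation: there are increasing sequences
  \<open>m\<^sub>0 < m\<^sub>1 < \<dots>\<close> in \<open>M\<close> and \<open>n\<^sub>0 < n\<^sub>1 < \<dots>\<close> such that, with \<open>N\<close> the range of \<open>n\<close>, every member
  \<open>{n\<^sub>i | i \<in> A}\<close> of \<open>G\<close> has the property that \<open>{m\<^sub>i | i \<in> A}\<close> has an initial segment in \<open>F\<close>;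
  that segment is its image. Order isomorphisms and passing to initial segments
  both keep plegma pairs plegma (\<open>plegma_pair_transfer\<close>), and the bound on minima holds
  because \<open>m\<close> runs through a subset of \<open>M\<close>.

  The sequences come from a diagonal choice (\<open>diagonal_sequence\<close>), where each new term only has
  to be large compared with the finitely many sets of earlier terms. Two requirements are met.

  First, a set \<open>{m\<^sub>i | i \<in> A}\<close> in \<open>R\<close> that is not a maximal node stays in \<open>R\<close> when any later \<open>m\<^sub>k\<close>
  is added. By spreading this holds for all large \<open>m\<^sub>k\<close>. Consequently a set of terms of \<open>m\<close>
  either belongs to \<open>R\<close> or has already passed through a maximal node of \<open>R\<close>, that is, through an
  element of \<open>F\<close>.

  Second, \<open>\<rho>(m ` A) \<le> \<rho>(n ` A)\<close> whenever \<open>m ` A \<in> R\<close>. For \<open>A = {}\<close> this is the hypothesis on the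
  orders of \<open>F\<close> and \<open>G\<close>. When \<open>m\<^sub>k\<close> is added, the rank of \<open>m ` A\<close> drops strictly, hence below
  \<open>\<rho>(n ` A)\<close>; the latter is the supremum of the successors of the ranks of the extensions of
  \<open>n ` A\<close>, so one of these has at least the required rank, and since ranks increase under spreading
  (\<open>node_order_spread_mono\<close>) every large \<open>n\<^sub>k\<close> will do (\<open>eventually_node_order_insert_ge\<close>).
  A member \<open>n ` A\<close> of \<open>G\<close> is maximal in \<open>S\<close> and so of rank zero; if \<open>m ` A\<close> lies in \<open>R\<close>,
  it has rank zero too, and is itself in \<open>F\<close>.
\<close>

section \<open>Enumerations and initial segments\<close>

lemma enumerate_strict_mono_image:
  fixes h :: "nat \<Rightarrow> nat"
  assumes "strict_mono_on s h" "infinite s \<or> k < card s"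
  shows "enumerate (h ` s) k = h (enumerate s k)"
  using assms
proof (induction k arbitrary: s)
  case (0 s)
  then have ne: "s \<noteq> {}" by auto
  define l where "l = (LEAST x. x \<in> s)"
  have l: "l \<in> s" "\<And>x. x \<in> s \<Longrightarrow> l \<le> x"
    using ne unfolding l_def by (auto intro: LeastI Least_le)
  have "(LEAST x. x \<in> h ` s) = h l"
    using l strict_mono_on_leD[OF "0.prems"(1)] by (intro Least_equality) auto
  then show ?case by (simp add: enumerate_0 l_def)
next
  case (Suc k s)
  then have ne: "s \<noteq> {}" by auto
  define l where "l = (LEAST x. x \<in> s)"
  have l: "l \<in> s" "\<And>x. x \<in> s \<Longrightarrow> l \<le> x"
    using ne unfolding l_def by (auto intro: LeastI Least_le)
  have hl: "(LEAST x. x \<in> h ` s) = h l"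
    using l strict_mono_on_leD[OF Suc.prems(1)] by (intro Least_equality) auto
  have "inj_on h s" using Suc.prems(1) by (rule strict_mono_on_imp_inj_on)
  then have im: "h ` s - {h l} = h ` (s - {l})"
    using l(1) by (auto simp: inj_on_def)
  have sm: "strict_mono_on (s - {l}) h"
    using Suc.prems(1) by (auto simp: strict_mono_on_def)
  have big: "infinite (s - {l}) \<or> k < card (s - {l})"
    using Suc.prems(2) l(1) by (cases "finite s") auto
  show ?case
    using Suc.IH[OF sm big] by (simp add: enumerate_Suc hl im flip: l_def)
qed

lemma enumerate_range:
  fixes n :: "nat \<Rightarrow> nat"
  assumes "strict_mono n"
  shows "enumerate (range n) k = n k"
proof -
  have "enumerate (UNIV :: nat set) k = k"
  proof (induction k)
    case (Suc k)
    have "(LEAST x. x \<in> UNIV \<and> k < x) = Suc k" by (intro Least_equality) auto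
    with Suc show ?case by (simp add: enumerate_Suc'')
  qed (simp add: enumerate_0 Least_equality)
  then show ?thesis using enumerate_strict_mono_image[OF assms] by simp
qed

lemma enumerate_init_seg:
  assumes "init_seg r s" "k < card r"
  shows "enumerate r k = enumerate s k"
  using assms
proof (induction k arbitrary: r s)
  case (0 r s)
  then have ne: "r \<noteq> {}" by auto
  define l where "l = (LEAST x. x \<in> r)"
  have l: "l \<in> r" "\<And>x. x \<in> r \<Longrightarrow> l \<le> x"
    using ne unfolding l_def by (auto intro: LeastI Least_le)
  have "(LEAST x. x \<in> s) = l"
    using l "0.prems"(1) unfolding init_seg_def
    by (intro Least_equality) (blast, metis linorder_not_less)
  then show ?case by (simp add: enumerate_0 l_def)
next
  case (Suc k r s)
  then have ne: "r \<noteq> {}" by auto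
  define l where "l = (LEAST x. x \<in> r)"
  have l: "l \<in> r" "\<And>x. x \<in> r \<Longrightarrow> l \<le> x"
    using ne unfolding l_def by (auto intro: LeastI Least_le)
  have ls: "(LEAST x. x \<in> s) = l"
    using l Suc.prems(1) unfolding init_seg_def
    by (intro Least_equality) (blast, metis linorder_not_less)
  have seg: "init_seg (r - {l}) (s - {l})"
    using Suc.prems(1) by (auto simp: init_seg_def)
  have big: "k < card (r - {l})"
    using Suc.prems(2) l(1) card.infinite[of r] by (cases "finite r") auto
  show ?case
    using Suc.IH[OF seg big] by (simp add: enumerate_Suc ls flip: l_def)
qed

lemma enumerate_le_strict_mono:
  fixes a :: "nat \<Rightarrow> nat"
  assumes "strict_mono a" "range a \<subseteq> M" "infinite M"
  shows "enumerate M k \<le> a k"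
proof (induction k)
  case 0
  then show ?case using assms(2) by (auto simp: enumerate_0 intro: Least_le)
next
  case (Suc k)
  moreover have "a k < a (Suc k)" using assms(1) by (simp add: strict_mono_def)
  ultimately have "a (Suc k) \<in> M \<and> enumerate M k < a (Suc k)" using assms(2) by auto
  then show ?case
    unfolding enumerate_Suc''[OF assms(3)] by (rule Least_le)
qed

lemma init_seg_trans: "init_seg r s \<Longrightarrow> init_seg s t \<Longrightarrow> init_seg r t"
  unfolding init_seg_def by blast

lemma init_seg_insert_above:
  assumes "\<forall>y\<in>s. y < x"
  shows "init_seg s (insert x s)"
  using assms by (auto simp: init_seg_def)

lemma proper_init_seg_insert_above:
  assumes "\<forall>y\<in>s. y < x"
  shows "proper_init_seg s (insert x s)"
  using init_seg_insert_above[OF assms] assms by (auto simp: proper_init_seg_def)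

lemma proper_init_seg_next:
  assumes "proper_init_seg s u"
  obtains x where "\<forall>y\<in>s. y < x" "x \<in> u" "init_seg (insert x s) u"
proof
  define x where "x = (LEAST x. x \<in> u - s)"
  have ne: "u - s \<noteq> {}" using assms by (auto simp: proper_init_seg_def init_seg_def)
  have x: "x \<in> u - s" unfolding x_def using ne by (metis LeastI ex_in_conv)
  have least: "x \<le> y" if "y \<in> u - s" for y unfolding x_def using that by (rule Least_le)
  show "\<forall>y\<in>s. y < x"
    using x assms unfolding proper_init_seg_def init_seg_def by (metis Diff_iff linorder_neqE_nat)
  show "x \<in> u" using x by simp
  show "init_seg (insert x s) u"
    using x least assms unfolding proper_init_seg_def init_seg_def
    by (metis Diff_iff insert_iff insert_subset not_le)
qed

section \<open>Countable ordinals\<close>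

lemma ord_succ_le_iff:
  assumes "a < top"
  shows "ord_succ a \<le> b \<longleftrightarrow> a < b"
proof
  show "a < b" if "ord_succ a \<le> b" using ord_succ_greater[OF assms] that by order
  show "ord_succ a \<le> b" if "a < b" unfolding ord_succ_def using that by (auto intro: Inf_lower)
qed

lemma le_of_less_ord_succ: "b < ord_succ a \<Longrightarrow> b \<le> a"
  unfolding ord_succ_def using Inf_lower[of b "{b. a < b}"] by (metis mem_Collect_eq not_le)

text \<open>
  \<open>\<omega>\<^sub>1\<close> is regular: the set of ordinals below a countable supremum of countable
  ordinals is a countable union of countable sets, while \<open>\<omega>\<^sub>1\<close> itself is uncountable.
\<close>

lemma Sup_countable_less_top:
  fixes A :: "ord_omega1 set"
  assumes "countable A" "\<And>a. a \<in> A \<Longrightarrow> a < top"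
  shows "Sup A < top"
proof (rule ccontr)
  assume "\<not> Sup A < top"
  then have "Sup A = top" using top.not_eq_extremum by blast
  then have "{b. b < top} \<subseteq> (\<Union>a\<in>A. {b. b < a})"
    using less_Sup_iff[of _ A] by auto
  moreover have "countable (\<Union>a\<in>A. {b. b < a})"
    using assms countable_below by (intro countable_UN) auto
  ultimately show False using uncountable_below_top countable_subset by blast
qed

lemma ord_succ_less_top:
  assumes "a < top"
  shows "ord_succ a < top"
proof (rule ccontr)
  assume "\<not> ord_succ a < top"
  then have "ord_succ a = top" using top.not_eq_extremum by blast
  then have "{b. b < (top :: ord_omega1)} \<subseteq> insert a {b. b < a}"
    using le_of_less_ord_succ[of _ a] by (auto simp: le_less)
  moreover have "countable (insert a {b. b < a})" using countable_below[OF assms] by simp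
  ultimately show False using uncountable_below_top countable_subset by blast
qed

section \<open>Ranks in regular families\<close>

lemma regularD:
  assumes "regular R"
  shows "\<And>s. s \<in> R \<Longrightarrow> finite s" "\<And>s. s \<in> R \<Longrightarrow> s \<subseteq> Npos"
    "\<And>s t. s \<in> R \<Longrightarrow> t \<subseteq> s \<Longrightarrow> t \<in> R"
  using assms by (auto simp: regular_def fin_subsets_def hereditary_def)

text \<open>
  The characteristic functions along an infinite chain converge pointwise to that of the union,
  which is infinite and therefore not the limit of members of a compact family of finite sets.
\<close>

lemma regular_no_infinite_chain:
  assumes "regular R"
  shows "\<not> has_infinite_chain R"
proof
  assume "has_infinite_chain R"
  then obtain f where f: "\<And>n. f n \<in> R" "\<And>n. proper_init_seg (f n) (f (Suc n))"
    unfolding has_infinite_chain_def by blast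
  note R = regularD[OF assms]
  define X where "X = (\<Union>n. f n)"
  have psub: "f n \<subset> f (Suc n)" for n
    using f(2)[of n] by (auto simp: proper_init_seg_def init_seg_def)
  have mono: "i \<le> j \<Longrightarrow> f i \<subseteq> f j" for i j
    using lift_Suc_mono_le[of f] psub by (metis psubset_imp_subset)
  have card: "n \<le> card (f n)" for n
  proof (induction n)
    case (Suc n)
    have "card (f n) < card (f (Suc n))" using psub R(1)[OF f(1)] by (rule psubset_card_mono[rotated])
    with Suc show ?case by simp
  qed simp
  have inf: "infinite X"
  proof
    assume "finite X"
    then have "card (f (Suc (card X))) \<le> card X" by (intro card_mono) (auto simp: X_def)
    with card[of "Suc (card X)"] show False by simp
  qed
  have Xpos: "X \<subseteq> Npos" using R(2)[OF f(1)] by (auto simp: X_def)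
  let ?T = "product_topology (\<lambda>_. discrete_topology {0, 1 :: nat}) Npos"
  have "limitin ?T (\<lambda>n. char_fun (f n)) (char_fun X) sequentially"
    unfolding limitin_componentwise
  proof (intro conjI ballI)
    show "char_fun X \<in> extensional Npos" by (simp add: char_fun_def)
    show "\<forall>\<^sub>F n in sequentially. char_fun (f n) \<in> topspace ?T"
      by (auto simp: char_fun_def)
    fix i :: nat assume i: "i \<in> Npos"
    have "\<forall>\<^sub>F n in sequentially. char_fun (f n) i = char_fun X i"
    proof (cases "i \<in> X")
      case True
      then obtain n0 where "i \<in> f n0" by (auto simp: X_def)
      then have "i \<in> f n" if "n0 \<le> n" for n using mono[OF that] by blast
      then show ?thesis using True
        by (auto simp: char_fun_def intro!: eventually_sequentiallyI[of n0])
    next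
      case False
      then show ?thesis by (auto simp: char_fun_def X_def)
    qed
    then show "limitin (discrete_topology {0, 1}) (\<lambda>n. char_fun (f n) i) (char_fun X i) sequentially"
      using i by (intro limitin_eventually) (auto simp: char_fun_def)
  qed
  moreover have "closedin ?T (char_fun ` R)"
    using assms by (simp add: regular_def compact_family_def)
  ultimately have "char_fun X \<in> char_fun ` R"
    by (rule limitin_closedin) (simp_all add: f(1))
  then obtain r where r: "r \<in> R" "char_fun X = char_fun r" by blast
  have "i \<in> X \<longleftrightarrow> i \<in> r" if "i \<in> Npos" for i
  proof -
    have "(if i \<in> X then 1 else 0 :: nat) = (if i \<in> r then 1 else 0)"
      using fun_cong[OF r(2), of i] that unfolding char_fun_def by simp
    then show ?thesis by (cases "i \<in> X"; cases "i \<in> r") simp_all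
  qed
  then have "X = r" using Xpos R(2)[OF r(1)] by blast
  with inf R(1)[OF r(1)] show False by simp
qed

lemma spreading_image:
  assumes "regular R" "s \<in> R" "strict_mono_on s h" "\<And>x. x \<in> s \<Longrightarrow> x \<le> h x"
  shows "h ` s \<in> R"
proof -
  have fin: "finite s" and pos: "s \<subseteq> Npos" using regularD[OF assms(1)] assms(2) by auto
  have "1 \<le> h x" if "x \<in> s" for x using assms(4)[OF that] pos that by fastforce
  then have "h ` s \<in> fin_subsets Npos" using fin by (auto simp: fin_subsets_def)
  moreover have "card (h ` s) = card s"
    using strict_mono_on_imp_inj_on[OF assms(3)] by (rule card_image)
  moreover have "nth_elem s k \<le> nth_elem (h ` s) k" if "1 \<le> k" "k \<le> card s" for k
  proof -
    have "k - 1 < card s" using that by simp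
    then show ?thesis
      unfolding nth_elem_def using enumerate_strict_mono_image[OF assms(3)]
      by (simp add: assms(4) finite_enumerate_in_set[OF fin])
  qed
  ultimately show ?thesis
    using assms(1,2) unfolding regular_def spreading_def by blast
qed

lemma node_order_less_top:
  assumes "regular R" "s \<in> R"
  shows "node_order R s < top"
  using assms(2)
proof (induction s rule: wf_induct_rule[OF wf_ext_rel[OF regular_no_infinite_chain[OF assms(1)]]])
  case (1 s)
  have "R \<subseteq> {A. finite A}" using regularD(1)[OF assms(1)] by blast
  then have "countable R" using countable_Collect_finite countable_subset by blast
  then have "countable {t \<in> R. proper_init_seg s t}" by (rule countable_subset[rotated]) auto
  moreover have "node_order R t < top" if "t \<in> R" "proper_init_seg s t" for t
    using "1.IH"[of t] "1.prems" that by (simp add: ext_rel_def)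
  ultimately have "(SUP t\<in>{t \<in> R. proper_init_seg s t}. ord_succ (node_order R t)) < top"
    by (intro Sup_countable_less_top countable_image) (blast intro: ord_succ_less_top)+
  then show ?case
    using node_order_eq[OF regular_no_infinite_chain[OF assms(1)] "1.prems"]
    by (rule ord_eq_less_trans[rotated])
qed

lemma node_order_proper_ext_less:
  assumes "regular R" "s \<in> R" "t \<in> R" "proper_init_seg s t"
  shows "node_order R t < node_order R s"
proof -
  have "ord_succ (node_order R t) \<le> (SUP t\<in>{t \<in> R. proper_init_seg s t}. ord_succ (node_order R t))"
    using assms(3,4) by (intro SUP_upper) simp
  also have "\<dots> = node_order R s"
    using node_order_eq[OF regular_no_infinite_chain[OF assms(1)] assms(2)] by (rule sym)
  finally show ?thesis using ord_succ_le_iff[OF node_order_less_top[OF assms(1,3)]] by blast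
qed

lemma node_order_ext_le:
  assumes "regular R" "s \<in> R" "t \<in> R" "init_seg s t"
  shows "node_order R t \<le> node_order R s"
proof (cases "s = t")
  case False
  with assms(4) have "node_order R t < node_order R s"
    by (intro node_order_proper_ext_less[OF assms(1-3)]) (simp add: proper_init_seg_def)
  then show ?thesis by (rule less_imp_le)
qed simp

text \<open>
  Pushing a node to the right does not lower its rank: each extension of \<open>s\<close> is pushed along, by
  translating its new elements beyond \<open>h ` s\<close>.
\<close>

lemma node_order_spread_mono:
  assumes "regular R" "s \<in> R" "strict_mono_on s h" "\<And>x. x \<in> s \<Longrightarrow> x \<le> h x"
  shows "node_order R s \<le> node_order R (h ` s)"
  using assms(2-4)
proof (induction s arbitrary: h
    rule: wf_induct_rule[OF wf_ext_rel[OF regular_no_infinite_chain[OF assms(1)]]])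
  case (1 s h)
  note chain = regular_no_infinite_chain[OF assms(1)]
  have hs: "h ` s \<in> R" using spreading_image[OF assms(1) "1.prems"] .
  have "ord_succ (node_order R t) \<le> node_order R (h ` s)" if t: "t \<in> R" "proper_init_seg s t" for t
  proof -
    define g where "g x = (if x \<in> s then h x else x + Max (h ` s))" for x
    have ab: "y < x" if "x \<in> t - s" "y \<in> s" for x y
      using t(2) that unfolding proper_init_seg_def init_seg_def
      by (metis Diff_iff linorder_neqE_nat)
    have sub: "s \<subseteq> t" using t(2) by (auto simp: proper_init_seg_def init_seg_def)
    have hmax: "h y \<le> Max (h ` s)" if "y \<in> s" for y
      using that regularD(1)[OF assms(1) hs] by simp
    have gmono: "strict_mono_on t g"
    proof (rule strict_mono_onI)
      fix x y assume xy: "x \<in> t" "y \<in> t" "x < y"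
      consider "x \<in> s" "y \<in> s" | "x \<in> s" "y \<notin> s" | "x \<notin> s" "y \<notin> s"
        using ab[of x y] xy by fastforce
      then show "g x < g y"
      proof cases
        case 1
        then show ?thesis using strict_mono_onD[OF \<open>strict_mono_on s h\<close>] xy(3) by (simp add: g_def)
      next
        case 2
        then show ?thesis using hmax[of x] xy(3) by (simp add: g_def)
      next
        case 3
        then show ?thesis using xy(3) by (simp add: g_def)
      qed
    qed
    have gge: "x \<le> g x" for x using "1.prems"(3) by (simp add: g_def)
    have gt: "g ` t \<in> R" using spreading_image[OF assms(1) t(1) gmono] gge by blast
    have gs: "g ` s = h ` s" by (simp add: g_def)
    have "init_seg (g ` s) (g ` t)"
      unfolding init_seg_def
    proof (intro conjI ballI impI)
      show "g ` s \<subseteq> g ` t" using sub by blast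
      fix u v assume "u \<in> g ` s" "v \<in> g ` t" "v < u"
      then obtain x y where xy: "x \<in> s" "u = g x" "y \<in> t" "v = g y" by blast
      have "y \<in> s"
      proof (rule ccontr)
        assume "y \<notin> s"
        then have "g x < g y"
          using ab[of y x] xy sub by (intro strict_mono_onD[OF gmono]) auto
        with xy \<open>v < u\<close> show False by simp
      qed
      then show "v \<in> g ` s" using xy by blast
    qed
    moreover have "g ` s \<noteq> g ` t"
      using strict_mono_on_imp_inj_on[OF gmono] sub t(2)
      by (auto simp: proper_init_seg_def inj_on_image_eq_iff)
    ultimately have "proper_init_seg (h ` s) (g ` t)" by (simp add: proper_init_seg_def gs)
    then have "node_order R (g ` t) < node_order R (h ` s)"
      by (rule node_order_proper_ext_less[OF assms(1) hs gt])
    moreover have "node_order R t \<le> node_order R (g ` t)"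
      using "1.IH"[of t g] "1.prems"(1) t gmono gge by (simp add: ext_rel_def)
    ultimately show ?thesis
      using ord_succ_le_iff[OF node_order_less_top[OF assms(1) t(1)]] by (metis order.strict_trans1)
  qed
  then have "(SUP t\<in>{t \<in> R. proper_init_seg s t}. ord_succ (node_order R t)) \<le> node_order R (h ` s)"
    by (intro SUP_least) simp
  then show ?case using node_order_eq[OF chain "1.prems"(1)] by (rule ord_eq_le_trans[rotated])
qed

lemma spread_last:
  assumes "regular R" "insert x s \<in> R" "\<forall>y\<in>s. y < x" "x \<le> z"
  shows "insert z s \<in> R" "node_order R (insert x s) \<le> node_order R (insert z s)"
proof -
  define h where "h y = (if y = x then z else y)" for y
  have "strict_mono_on (insert x s) h"
    using assms(3,4) by (fastforce simp: strict_mono_on_def h_def)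
  moreover have "h ` insert x s = insert z s" using assms(3) by (auto simp: h_def)
  moreover have "y \<le> h y" for y using assms(4) by (simp add: h_def)
  ultimately show "insert z s \<in> R" "node_order R (insert x s) \<le> node_order R (insert z s)"
    using spreading_image[OF assms(1,2)] node_order_spread_mono[OF assms(1,2)] by metis+
qed

text \<open>
  One extension is enough: its first new element \<open>x\<close> may be moved to any larger value by spreading.
\<close>

lemma eventually_insert_mem:
  assumes "regular R" "u \<in> R" "proper_init_seg s u"
  shows "\<forall>\<^sub>F x in sequentially. insert x s \<in> R"
proof -
  obtain x where x: "\<forall>y\<in>s. y < x" "x \<in> u" "init_seg (insert x s) u"
    using proper_init_seg_next[OF assms(3)] .
  then have "insert x s \<in> R" using assms(2) regularD(3)[OF assms(1)] by (auto simp: init_seg_def)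
  then show ?thesis
    using spread_last(1)[OF assms(1) _ x(1)] by (blast intro: eventually_sequentiallyI[of x])
qed

text \<open>
  The rank of \<open>s\<close> is a supremum over all extensions of \<open>s\<close>, possibly longer by many elements. Cutting
  an extension down to its first new element can only raise the rank, and so can moving that
  element to the right.
\<close>

lemma eventually_node_order_insert_ge:
  assumes "regular S" "s \<in> S" "\<alpha> < node_order S s"
  shows "\<forall>\<^sub>F x in sequentially. insert x s \<in> S \<and> \<alpha> \<le> node_order S (insert x s)"
proof -
  obtain u where u: "u \<in> S" "proper_init_seg s u" "\<alpha> < ord_succ (node_order S u)"
    using assms(3) unfolding node_order_eq[OF regular_no_infinite_chain[OF assms(1)] assms(2)]
    by (auto simp: less_SUP_iff)
  obtain x where x: "\<forall>y\<in>s. y < x" "x \<in> u" "init_seg (insert x s) u"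
    using proper_init_seg_next[OF u(2)] .
  then have xs: "insert x s \<in> S" using u(1) regularD(3)[OF assms(1)] by (auto simp: init_seg_def)
  have "\<alpha> \<le> node_order S u" using u(3) by (rule le_of_less_ord_succ)
  also have "\<dots> \<le> node_order S (insert x s)"
    by (rule node_order_ext_le[OF assms(1) xs u(1) x(3)])
  finally show ?thesis
    using spread_last[OF assms(1) xs x(1)] order_trans
    by (intro eventually_sequentiallyI[of x]) blast
qed

section \<open>Regular thin families\<close>

lemma mem_hat: "s \<in> F \<Longrightarrow> regular_thin F \<Longrightarrow> s \<in> hat F"
  by (auto simp: hat_def regular_thin_def init_seg_def)

lemma hat_maximal_mem:
  assumes "regular_thin F" "s \<in> hat F" "\<And>u. u \<in> hat F \<Longrightarrow> \<not> proper_init_seg s u"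
  shows "s \<in> F"
proof -
  obtain u where "u \<in> F" "init_seg s u" using assms(2) by (auto simp: hat_def)
  with assms(3) mem_hat[OF _ assms(1)] show ?thesis by (auto simp: proper_init_seg_def)
qed

lemma thin_maximal_hat:
  assumes "regular_thin F" "s \<in> F" "u \<in> hat F"
  shows "\<not> proper_init_seg s u"
proof
  assume su: "proper_init_seg s u"
  obtain v where v: "v \<in> F" "init_seg u v" using assms(3) by (auto simp: hat_def)
  have "init_seg s v" using su v(2) init_seg_trans unfolding proper_init_seg_def by blast
  moreover have "s \<subset> u" "u \<subseteq> v" using su v(2) unfolding proper_init_seg_def init_seg_def by blast+
  ultimately have "proper_init_seg s v" unfolding proper_init_seg_def by blast
  with assms(1,2) v(1) show False unfolding regular_thin_def thin_def by blast
qed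

lemma node_order_mem_thin:
  assumes "regular_thin F" "s \<in> F"
  shows "node_order (hat F) s = bot"
  using assms thin_maximal_hat mem_hat
  by (intro node_order_maximal regular_no_infinite_chain) (auto simp: regular_thin_def)

section \<open>The diagonal choice\<close>

text \<open>
  The predicate sees the index set \<open>A\<close> and the next index \<open>k\<close> besides the terms chosen so far, so
  that a second sequence can be built against a first one.
\<close>

lemma diagonal_sequence:
  fixes Q :: "nat set \<Rightarrow> nat \<Rightarrow> nat set \<Rightarrow> nat \<Rightarrow> bool"
  assumes "infinite X"
    and ev: "\<And>A k B. finite B \<Longrightarrow> \<forall>\<^sub>F x in sequentially. Q A k B x"
  shows "\<exists>a. strict_mono a \<and> range a \<subseteq> X \<and> (\<forall>k A. A \<subseteq> {..<k} \<longrightarrow> Q A k (a ` A) (a k))"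
proof -
  have "\<exists>a. \<forall>k. a k \<in> X \<and> (\<forall>j<k. a j < a k) \<and> (\<forall>A\<subseteq>{..<k}. Q A k (a ` A) (a k))"
  proof (rule dependent_wellorder_choice)
    fix r k and f g :: "nat \<Rightarrow> nat"
    assume eq: "\<And>y. y < k \<Longrightarrow> f y = g y"
    then have "f ` A = g ` A" if "A \<subseteq> {..<k}" for A using that by (intro image_cong) auto
    with eq show "(r \<in> X \<and> (\<forall>j<k. f j < r) \<and> (\<forall>A\<subseteq>{..<k}. Q A k (f ` A) r)) =
        (r \<in> X \<and> (\<forall>j<k. g j < r) \<and> (\<forall>A\<subseteq>{..<k}. Q A k (g ` A) r))" by auto
  next
    fix k and f :: "nat \<Rightarrow> nat"
    have "\<forall>\<^sub>F x in sequentially. \<forall>A\<in>Pow {..<k}. Q A k (f ` A) x"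
      by (intro eventually_ball_finite ballI ev) (auto intro: finite_subset)
    moreover have "\<forall>\<^sub>F x in sequentially. \<forall>j\<in>{..<k}. f j < x"
      by (intro eventually_ball_finite ballI eventually_gt_at_top) auto
    ultimately obtain x0 where x0: "\<And>x. x0 \<le> x \<Longrightarrow>
        (\<forall>A\<in>Pow {..<k}. Q A k (f ` A) x) \<and> (\<forall>j\<in>{..<k}. f j < x)"
      unfolding eventually_sequentially by (metis le_trans linear)
    obtain x where "x \<in> X" "x0 \<le> x"
      using assms(1) unfolding infinite_nat_iff_unbounded_le by blast
    then show "\<exists>r. r \<in> X \<and> (\<forall>j<k. f j < r) \<and> (\<forall>A\<subseteq>{..<k}. Q A k (f ` A) r)"
      using x0[of x] by auto
  qed
  then show ?thesis
    unfolding strict_mono_def by (metis image_subsetI)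
qed

text \<open>
  Any index set is reached from \<open>{}\<close> by adding elements in increasing order, so both properties
  required of the sequences need only be secured one step at a time.
\<close>

lemma exists_rank_dominating_sequences:
  assumes F: "regular_thin F" and G: "regular_thin G" and ne: "F \<noteq> {}" "G \<noteq> {}"
    and le: "family_order F \<le> family_order G" and M: "M \<in> inf_subsets Npos"
  obtains m n :: "nat \<Rightarrow> nat" where
    "strict_mono m" "range m \<subseteq> M" "strict_mono n" "range n \<subseteq> Npos"
    "\<And>A. finite A \<Longrightarrow> m ` A \<in> hat F \<or> (\<exists>r\<in>F. init_seg r (m ` A))"
    "\<And>A. finite A \<Longrightarrow> m ` A \<in> hat F \<Longrightarrow>
       n ` A \<in> hat G \<and> node_order (hat F) (m ` A) \<le> node_order (hat G) (n ` A)"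
proof -
  define R S where "R = hat F" and "S = hat G"
  have R: "regular R" and S: "regular S" using F G by (auto simp: regular_thin_def R_def S_def)
  have "{} \<in> R" "{} \<in> S" using ne by (auto simp: R_def S_def hat_def fin_subsets_def init_seg_def)
  have le0: "node_order R {} \<le> node_order S {}"
    using le regular_no_infinite_chain[OF R] regular_no_infinite_chain[OF S]
    by (simp add: family_order_def R_def S_def)
  have "infinite M" "M \<subseteq> Npos" using M by (auto simp: inf_subsets_def)
  \<comment> \<open>\<open>R\<close> does not involve \<open>n\<close>, so \<open>m\<close> can be completed first and \<open>n\<close> chosen against it.\<close>
  have "\<exists>m :: nat \<Rightarrow> nat. strict_mono m \<and> range m \<subseteq> M \<and> (\<forall>k A. A \<subseteq> {..<k} \<longrightarrow>
       (\<exists>u\<in>R. proper_init_seg (m ` A) u) \<longrightarrow> insert (m k) (m ` A) \<in> R)"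
  proof (rule diagonal_sequence[OF \<open>infinite M\<close>,
        of "\<lambda>A k B x. (\<exists>u\<in>R. proper_init_seg B u) \<longrightarrow> insert x B \<in> R"])
    fix B :: "nat set"
    show "\<forall>\<^sub>F x in sequentially. (\<exists>u\<in>R. proper_init_seg B u) \<longrightarrow> insert x B \<in> R"
      using eventually_insert_mem[OF R, of _ B] by (cases "\<exists>u\<in>R. proper_init_seg B u") auto
  qed
  then obtain m :: "nat \<Rightarrow> nat" where m: "strict_mono m" "range m \<subseteq> M"
    "\<forall>k A. A \<subseteq> {..<k} \<longrightarrow>
       (\<exists>u\<in>R. proper_init_seg (m ` A) u) \<longrightarrow> insert (m k) (m ` A) \<in> R"
    by blast
  have up: "\<forall>y\<in>m ` A. y < m k" if "A \<subseteq> {..<k}" for A k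
    using m(1) that by (auto simp: strict_mono_def)
  have "\<exists>n :: nat \<Rightarrow> nat. strict_mono n \<and> range n \<subseteq> Npos \<and> (\<forall>k A. A \<subseteq> {..<k} \<longrightarrow>
       n ` A \<in> S \<and> node_order R (insert (m k) (m ` A)) < node_order S (n ` A) \<longrightarrow>
       insert (n k) (n ` A) \<in> S \<and>
       node_order R (insert (m k) (m ` A)) \<le> node_order S (insert (n k) (n ` A)))"
  proof (rule diagonal_sequence[of Npos "\<lambda>A k B x.
       B \<in> S \<and> node_order R (insert (m k) (m ` A)) < node_order S B \<longrightarrow>
       insert x B \<in> S \<and>
       node_order R (insert (m k) (m ` A)) \<le> node_order S (insert x B)"])
    show "infinite Npos" by (rule infinite_Ici)
    fix A k and B :: "nat set"
    let ?\<alpha> = "node_order R (insert (m k) (m ` A))"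
    show "\<forall>\<^sub>F x in sequentially. B \<in> S \<and> ?\<alpha> < node_order S B \<longrightarrow>
        insert x B \<in> S \<and> ?\<alpha> \<le> node_order S (insert x B)"
      using eventually_node_order_insert_ge[OF S, of B ?\<alpha>]
      by (cases "B \<in> S \<and> ?\<alpha> < node_order S B") auto
  qed
  then obtain n :: "nat \<Rightarrow> nat" where n: "strict_mono n" "range n \<subseteq> Npos"
    "\<forall>k A. A \<subseteq> {..<k} \<longrightarrow>
       n ` A \<in> S \<and> node_order R (insert (m k) (m ` A)) < node_order S (n ` A) \<longrightarrow>
       insert (n k) (n ` A) \<in> S \<and>
       node_order R (insert (m k) (m ` A)) \<le> node_order S (insert (n k) (n ` A))"
    by blast
  have large: "m ` A \<in> R \<or> (\<exists>r\<in>F. init_seg r (m ` A))" if "finite A" for A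
    using that
  proof (induction rule: finite_linorder_max_induct)
    case empty
    then show ?case using \<open>{} \<in> R\<close> by simp
  next
    case (insert k A)
    then have A: "A \<subseteq> {..<k}" by auto
    have seg: "init_seg (m ` A) (m ` insert k A)"
      using init_seg_insert_above[OF up[OF A]] by simp
    show ?case
    proof (cases "\<exists>r\<in>F. init_seg r (m ` A)")
      case True
      then show ?thesis using init_seg_trans[OF _ seg] by blast
    next
      case False
      with insert.IH have mA: "m ` A \<in> R" by blast
      have "m ` A \<notin> F" using False by (auto simp: init_seg_def)
      then have "\<exists>u\<in>R. proper_init_seg (m ` A) u"
        using hat_maximal_mem[OF F] mA unfolding R_def by blast
      then show ?thesis using m(3) A by simp
    qed
  qed
  have dom: "n ` A \<in> S \<and> node_order R (m ` A) \<le> node_order S (n ` A)"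
    if "finite A" "m ` A \<in> R" for A
    using that
  proof (induction rule: finite_linorder_max_induct)
    case empty
    then show ?case using le0 \<open>{} \<in> S\<close> by simp
  next
    case (insert k A)
    then have A: "A \<subseteq> {..<k}" by auto
    have ins: "insert (m k) (m ` A) \<in> R" using insert.prems by simp
    have mA: "m ` A \<in> R" using regularD(3)[OF R ins] by blast
    have "node_order R (insert (m k) (m ` A)) < node_order R (m ` A)"
      by (rule node_order_proper_ext_less[OF R mA ins proper_init_seg_insert_above[OF up[OF A]]])
    also have "\<dots> \<le> node_order S (n ` A)" using insert.IH[OF mA] by blast
    finally show ?case using n(3) A insert.IH[OF mA] by simp
  qed
  show ?thesis
    using that[of m n] m(1,2) n(1,2) large dom unfolding R_def S_def by blast
qed

section \<open>Plegma pairs under relabelling\<close>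

text \<open>
  The plegma conditions compare equally or adjacently indexed elements. An order isomorphism
  preserves each comparison, and passing to initial segments only discards some of them.
\<close>

lemma plegma_pair_transfer:
  fixes m n :: "nat \<Rightarrow> nat"
  assumes pl: "plegma_pair (n ` A) (n ` B)" and mono: "strict_mono m" "strict_mono n"
    and seg: "init_seg r (m ` A)" "init_seg q (m ` B)"
    and rq: "r \<in> fin_subsets Npos" "q \<in> fin_subsets Npos" "r \<noteq> {}" "q \<noteq> {}"
  shows "plegma_pair r q"
proof -
  define full where "full s C \<longleftrightarrow> finite C \<and> init_seg s (m ` C)" for s C
  have cards: "card s \<le> card C" "card (n ` C) = card C" if "full s C" for s C
  proof -
    have "inj m" "inj n" using mono by (auto intro: strict_mono_imp_inj_on)
    then have inj: "inj_on m C" "inj_on n C" by (auto intro: inj_on_subset)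
    show "card (n ` C) = card C" using inj(2) by (rule card_image)
    have "card s \<le> card (m ` C)" using that unfolding full_def init_seg_def by (intro card_mono) auto
    then show "card s \<le> card C" by (simp add: card_image[OF inj(1)])
  qed
  have mon: "strict_mono_on C m" "strict_mono_on C n" for C
    using mono by (auto simp: strict_mono_def strict_mono_on_def)
  have less: "nth_elem s k < nth_elem s' k'"
    if "full s C" "full s' C'" "1 \<le> k" "k \<le> card s" "1 \<le> k'" "k' \<le> card s'"
      "nth_elem (n ` C) k < nth_elem (n ` C') k'" for s C s' C' k k'
  proof -
    have b: "k - 1 < card s" "k' - 1 < card s'" "k - 1 < card C" "k' - 1 < card C'"
      using that cards(1)[of s C] cards(1)[of s' C'] by auto
    have "enumerate s (k - 1) = m (enumerate C (k - 1))"
      "enumerate s' (k' - 1) = m (enumerate C' (k' - 1))"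
      using that(1,2) b enumerate_init_seg enumerate_strict_mono_image[OF mon(1)]
      unfolding full_def by metis+
    moreover have "enumerate (n ` C) (k - 1) = n (enumerate C (k - 1))"
      "enumerate (n ` C') (k' - 1) = n (enumerate C' (k' - 1))"
      using b enumerate_strict_mono_image[OF mon(2)] by metis+
    ultimately show ?thesis
      using that(7) by (simp add: nth_elem_def strict_mono_less[OF mono(1)] strict_mono_less[OF mono(2)])
  qed
  have finAB: "finite A" "finite B"
    using pl strict_mono_imp_inj_on[OF mono(2)] unfolding plegma_pair_def fin_subsets_def
    by (auto dest: finite_imageD intro: inj_on_subset)
  then have full: "full r A" "full q B" using seg by (auto simp: full_def)
  note c = cards[OF full(1)] cards[OF full(2)]
  have "nth_elem r k < nth_elem q k" if "1 \<le> k" "k \<le> min (card r) (card q)" for k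
    using that pl c by (intro less[OF full]) (auto simp: plegma_pair_def)
  moreover have "nth_elem s k < nth_elem t (k + 1)"
    if st: "(s, C) \<in> {(r, A), (q, B)}" "(t, D) \<in> {(r, A), (q, B)}"
      and k: "1 \<le> k" "k \<le> min (card s) (card t - 1)" for s t k C D
  proof -
    have f: "full s C" "full t D" using st full by auto
    have CD: "n ` C \<in> {n ` A, n ` B}" "n ` D \<in> {n ` A, n ` B}" using st by auto
    have "k \<le> min (card (n ` C)) (card (n ` D) - 1)"
      using k cards[OF f(1)] cards[OF f(2)] by auto
    then have "nth_elem (n ` C) k < nth_elem (n ` D) (k + 1)"
      using pl CD k(1) unfolding plegma_pair_def by blast
    then show ?thesis using k by (intro less[OF f]) auto
  qed
  ultimately show ?thesis
    using rq unfolding plegma_pair_def by blast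
qed

section \<open>Plegma preserving maps between regular thin families\<close>

theorem theorem3p16:
  fixes F G :: "nat set set"
  assumes "regular_thin F" and "regular_thin G"
    and "F \<noteq> {}" and "G \<noteq> {}"
    and "F = {{}} \<Longrightarrow> G = {{}}"
    and "family_order F \<le> family_order G"
  shows "\<forall>M\<in>inf_subsets Npos. \<exists>N\<in>inf_subsets Npos. \<exists>\<phi>.
    \<phi> \<in> restrict_family G N \<rightarrow> restrict_family F M \<and>
    plegma_preserving (restrict_family G N) \<phi> \<and>
    (\<forall>l\<ge>1. \<forall>t\<in>restrict_family G N. nth_elem N l \<le> Min t \<longrightarrow> nth_elem M l \<le> Min (\<phi> t))"
proof
  fix M assume M: "M \<in> inf_subsets Npos"
  show "\<exists>N\<in>inf_subsets Npos. \<exists>\<phi>. \<phi> \<in> restrict_family G N \<rightarrow> restrict_family F M \<and>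
    plegma_preserving (restrict_family G N) \<phi> \<and>
    (\<forall>l\<ge>1. \<forall>t\<in>restrict_family G N. nth_elem N l \<le> Min t \<longrightarrow> nth_elem M l \<le> Min (\<phi> t))"
  proof (cases "F = {{}}")
    case True
    with assms(5) have "G = F" by simp
    then show ?thesis
      by (intro bexI[of _ M] exI[of _ id] M) (auto simp: plegma_preserving_def)
  next
    case False
    \<comment> \<open>By thinness \<open>{}\<close> can only be the sole member.\<close>
    have noempty: "{} \<notin> F"
    proof
      assume "{} \<in> F"
      then have "s = {}" if "s \<in> F" for s
        using assms(1) that unfolding regular_thin_def thin_def proper_init_seg_def init_seg_def
        by blast
      with assms(3) False show False by blast
    qed
    obtain m n :: "nat \<Rightarrow> nat" where m: "strict_mono m" "range m \<subseteq> M"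
      and n: "strict_mono n" "range n \<subseteq> Npos"
      and large: "\<And>A. finite A \<Longrightarrow> m ` A \<in> hat F \<or> (\<exists>r\<in>F. init_seg r (m ` A))"
      and dom: "\<And>A. finite A \<Longrightarrow> m ` A \<in> hat F \<Longrightarrow>
        n ` A \<in> hat G \<and> node_order (hat F) (m ` A) \<le> node_order (hat G) (n ` A)"
      using exists_rank_dominating_sequences[OF assms(1-4,6) M] by blast
    have inj: "inj n" using n(1) by (rule strict_mono_imp_inj_on)
    define N where "N = range n"
    have N: "N \<in> inf_subsets Npos"
      using n(2) range_inj_infinite[OF inj] by (auto simp: inf_subsets_def N_def)
    have seg: "\<exists>r\<in>F. init_seg r (m ` A)" if t: "n ` A \<in> G" for A
    proof -
      have fin: "finite A"
        using t assms(2) inj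
        by (auto simp: regular_thin_def fin_subsets_def intro: finite_imageD inj_on_subset)
      show ?thesis
      proof (cases "m ` A \<in> hat F")
        case True
        \<comment> \<open>Rank zero on the side of \<open>G\<close> forces rank zero, hence maximality, on the side of \<open>F\<close>.\<close>
        have "node_order (hat F) (m ` A) = bot"
          using dom[OF fin True] node_order_mem_thin[OF assms(2) t] by (simp add: bot_unique)
        then have "\<not> proper_init_seg (m ` A) u" if "u \<in> hat F" for u
          using node_order_proper_ext_less[of "hat F", OF _ True that] assms(1)
          by (auto simp: regular_thin_def)
        then have "m ` A \<in> F" using hat_maximal_mem[OF assms(1) True] by blast
        then show ?thesis by (auto simp: init_seg_def)
      qed (use large[OF fin] in blast)
    qed
    define \<phi> where "\<phi> t = (SOME r. r \<in> F \<and> init_seg r (m ` (n -` t)))" for t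
    have preim: "n ` (n -` t) = t" if "t \<in> restrict_family G N" for t
      using that by (auto simp: restrict_family_def fin_subsets_def N_def)
    have \<phi>: "\<phi> t \<in> F" "init_seg (\<phi> t) (m ` (n -` t))" if t: "t \<in> restrict_family G N" for t
    proof -
      have "n ` (n -` t) \<in> G" using preim[OF t] t by (simp add: restrict_family_def)
      from someI_ex[OF seg[OF this, unfolded Bex_def]]
      show "\<phi> t \<in> F" "init_seg (\<phi> t) (m ` (n -` t))" by (auto simp: \<phi>_def)
    qed
    have fin: "\<phi> t \<in> fin_subsets Npos" "\<phi> t \<noteq> {}" if "t \<in> restrict_family G N" for t
      using \<phi>(1)[OF that] assms(1) noempty by (auto simp: regular_thin_def)
    have "\<phi> t \<in> restrict_family F M" if "t \<in> restrict_family G N" for t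
    proof -
      have "\<phi> t \<subseteq> M" using \<phi>(2)[OF that] m(2) unfolding init_seg_def by blast
      then show ?thesis
        using \<phi>(1)[OF that] fin(1)[OF that] by (simp add: restrict_family_def fin_subsets_def)
    qed
    moreover have "plegma_preserving (restrict_family G N) \<phi>"
      unfolding plegma_preserving_def
      using plegma_pair_transfer[OF _ m(1) n(1) \<phi>(2) \<phi>(2)] fin preim by simp
    moreover have "nth_elem M l \<le> Min (\<phi> t)"
      if t: "t \<in> restrict_family G N" and l: "l \<ge> 1" "nth_elem N l \<le> Min t" for t l
    proof -
      have "finite (\<phi> t)" using fin(1)[OF t] by (simp add: fin_subsets_def)
      then have "Min (\<phi> t) \<in> \<phi> t" using fin(2)[OF t] by simp
      then obtain j where j: "Min (\<phi> t) = m j" "n j \<in> t"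
        using \<phi>(2)[OF t] by (auto simp: init_seg_def)
      have "nth_elem N l = n (l - 1)"
        using enumerate_range[OF n(1)] by (simp add: nth_elem_def N_def)
      moreover have "Min t \<le> n j"
        using j(2) t by (auto simp: restrict_family_def fin_subsets_def)
      ultimately have "n (l - 1) \<le> n j" using l(2) by simp
      then have "l - 1 \<le> j" using strict_mono_less_eq[OF n(1)] by blast
      then have "m (l - 1) \<le> m j" using strict_mono_less_eq[OF m(1)] by blast
      moreover have "nth_elem M l \<le> m (l - 1)"
        unfolding nth_elem_def using M by (intro enumerate_le_strict_mono m) (auto simp: inf_subsets_def)
      ultimately show ?thesis using j(1) by simp
    qed
    ultimately show ?thesis by (intro bexI[of _ N] exI[of _ \<phi>] N) auto
  qed
qed

end
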